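(* Let $R, S, P, C \in M_k$ be such that $P$ is positive definite and $C$ is a strict contraction, and let $\gamma \in \mathbb{R}$. Then each of the following holds. (a) There is a $Z \in M_k$ such that $$I_k + RZ + Z^*S^* - Z^*Z = 0_k.$$ (b) There is a $Z \in M_k$ such that $$I_k + RZ + Z^*R^* - Z^*Z = 0_k \quad\text{and}\quad SZ + Z^*S^* = 0_k.$$ (c) There is a $Z \in M_k$ such that $$I_k + RZ + Z^*R^* - Z^*Z = 0_k \quad\text{and}\quad I_k + SZ + Z^*S^* - Z^*Z = 0_k.$$ (d) There is a Hermitian $H \in M_k$ such that $$I_k + RH + HR^* - HPH = \gamma H.$$ (e) There is a unitary $U \in M_k$ such that $$SR^* + RS^* = SU\sqrt{I_k + RR^*} + \sqrt{I_k + RR^*}\,U^*S^*.$$ (f) There are a unitary $U \in M_k$ and a Hermitian $H \in M_k$ such that $$C = U + PH.$$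
   Context: $M_k$ is the algebra of $k\times k$ complex matrices, $X^*$ is the conjugate transpose of $X$, $I_k$ and $0_k$ are the $k \times k$ identity and zero matrices, and $\sqrt{X}$ is the positive semidefinite square root of a positive semidefinite matrix $X$. A positive definite matrix is in particular Hermitian. A strict contraction is a matrix with operator (spectral) norm strictly less than $1$. *)

theory Defs
  imports "HOL-Analysis.Analysis"
begin

(* M_k is the type complex^'n^'n with k = CARD('n). *)
type_synonym 'n cmat = "complex^'n^'n"

definition conj_transpose :: "'n::finite cmat \<Rightarrow> 'n cmat"  (\<open>(_\<^sup>\<dagger>)\<close> [1000] 999)
  where "A\<^sup>\<dagger> = map_matrix cnj (transpose A)"

definition hermitian_mat :: "'n::finite cmat \<Rightarrow> bool"
  where "hermitian_mat A \<longleftrightarrow> A\<^sup>\<dagger> = A"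

definition unitary_mat :: "'n::finite cmat \<Rightarrow> bool"
  where "unitary_mat U \<longleftrightarrow> U\<^sup>\<dagger> ** U = mat 1 \<and> U ** U\<^sup>\<dagger> = mat 1"

(* x^* A x; it is real when A is Hermitian, so below only its real part is compared with 0. *)
definition quad_form :: "'n::finite cmat \<Rightarrow> complex^'n \<Rightarrow> complex"
  where "quad_form A x = (\<Sum>i\<in>UNIV. cnj (x $ i) * (A *v x) $ i)"

definition pos_semidef_mat :: "'n::finite cmat \<Rightarrow> bool"
  where "pos_semidef_mat A \<longleftrightarrow> hermitian_mat A \<and> (\<forall>x. 0 \<le> Re (quad_form A x))"

definition pos_def_mat :: "'n::finite cmat \<Rightarrow> bool"
  where "pos_def_mat A \<longleftrightarrow> hermitian_mat A \<and> (\<forall>x. x \<noteq> 0 \<longrightarrow> 0 < Re (quad_form A x))"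

(* Every positive semidefinite A has exactly one positive semidefinite square root;
   the value is unspecified for other A. *)
definition psd_sqrt :: "'n::finite cmat \<Rightarrow> 'n cmat"
  where "psd_sqrt A = (THE B. pos_semidef_mat B \<and> B ** B = A)"

(* The norm on complex^'n is the Euclidean one, so onorm is the spectral norm. *)
definition strict_contraction :: "'n::finite cmat \<Rightarrow> bool"
  where "strict_contraction C \<longleftrightarrow> onorm (\<lambda>x. C *v x) < 1"

end

theory Submission
  imports Defs "HOL-Computational_Algebra.Polynomial"
begin

text \<open>
  Everything reduces to the algebraic Riccati equation Q + A L + L A* - L P L = 0 with Q and P
  positive definite, which has a positive definite solution L: a matrix of minimal trace among
  those with 0 <= L <= c I and Q + A L + L A* - L P L <= 0. Such an L is positive definite
  and F = A - L P satisfies F L + L F* < 0, so the Lyapunov equation F D + D F* = X is solvable and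
  the Newton step L + D would have smaller trace if L were not a solution.

  Equations (d) and (f) are Riccati equations for H. For invertible S, the ansatz Z = B L with B
  the inverse of S turns the equation of (b), with S Z required to be Hermitian, into a Riccati
  equation for the Hermitian matrix L. The solutions Z of the first equation of (b) form a compact
  set, so the case of singular S follows by approximation. Multiplying S by the imaginary unit gives
  (b); replacing R, S by (R + S)/2, (R - S)/2 gives (a); replacing S by S - R gives (c). Finally,
  the first equation of (b) says that (R* - Z)* (R* - Z) = I + R R*, so U is (R* - Z) times
  the inverse of sqrt(I + R R*) in (e).
\<close>

section \<open>Matrix arithmetic, the real inner product and continuity\<close>

lemma ct_nth [simp]: "A\<^sup>\<dagger> $ i $ j = cnj (A $ j $ i)"
  by (simp add: conj_transpose_def transpose_def)

lemma ct_ct [simp]: "(A\<^sup>\<dagger>)\<^sup>\<dagger> = A"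
  by (simp add: vec_eq_iff)

lemma ct_zero [simp]: "(0 :: 'n::finite cmat)\<^sup>\<dagger> = 0"
  by (simp add: vec_eq_iff)

lemma ct_mat [simp]: "(mat c)\<^sup>\<dagger> = mat (cnj c)"
  by (simp add: vec_eq_iff mat_def)

lemma ct_add: "(A + B)\<^sup>\<dagger> = A\<^sup>\<dagger> + B\<^sup>\<dagger>"
  by (simp add: vec_eq_iff)

lemma ct_diff: "(A - B)\<^sup>\<dagger> = A\<^sup>\<dagger> - B\<^sup>\<dagger>"
  by (simp add: vec_eq_iff)

lemma ct_scaleR: "(a *\<^sub>R A)\<^sup>\<dagger> = a *\<^sub>R A\<^sup>\<dagger>"
  by (simp add: vec_eq_iff)

lemma ct_mult: "(A ** B)\<^sup>\<dagger> = B\<^sup>\<dagger> ** A\<^sup>\<dagger>"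
  by (simp add: vec_eq_iff matrix_matrix_mult_def mult.commute)

lemma matrix_add_rdistrib: "(B + C) ** A = B ** A + C ** (A :: 'n::finite cmat)"
  by (simp add: vec_eq_iff matrix_matrix_mult_def algebra_simps sum.distrib)

lemma matrix_minus_ldistrib: "A ** (B - C) = A ** B - A ** (C :: 'n::finite cmat)"
  by (simp add: vec_eq_iff matrix_matrix_mult_def algebra_simps sum_subtractf)

lemma matrix_minus_rdistrib: "(B - C) ** A = B ** A - C ** (A :: 'n::finite cmat)"
  by (simp add: vec_eq_iff matrix_matrix_mult_def algebra_simps sum_subtractf)

lemma scaleR_matrix_mult: "(a *\<^sub>R A) ** B = a *\<^sub>R (A ** (B :: 'n::finite cmat))"
  by (simp add: vec_eq_iff matrix_matrix_mult_def scaleR_sum_right)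

lemma matrix_mult_scaleR: "A ** (a *\<^sub>R B) = a *\<^sub>R (A ** (B :: 'n::finite cmat))"
  by (simp add: vec_eq_iff matrix_matrix_mult_def scaleR_sum_right)

lemma scaleR_matrix_vector: "(a *\<^sub>R A) *v x = a *\<^sub>R ((A :: 'n::finite cmat) *v x)"
  by (simp add: vec_eq_iff matrix_vector_mult_def scaleR_sum_right)

lemma matrix_vector_scaleR: "A *v (a *\<^sub>R x) = a *\<^sub>R (A *v (x :: complex^'n::finite))"
  by (simp add: vec_eq_iff matrix_vector_mult_def scaleR_sum_right)

lemmas cmat_simps = matrix_mul_assoc matrix_add_ldistrib matrix_add_rdistrib
  matrix_minus_ldistrib matrix_minus_rdistrib scaleR_matrix_mult matrix_mult_scaleR
  ct_add ct_diff ct_scaleR ct_mult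

text \<open>The library inner product on \<open>complex^'n\<close> is real-valued, namely the real
  part of the Hermitian one. Taking real parts of the usual adjoint identity shows that the
  conjugate transpose is also the adjoint for it.\<close>

lemma inner_matrix_vector: "x \<bullet> (A *v y) = (A\<^sup>\<dagger> *v x) \<bullet> (y :: complex^'n::finite)"
proof -
  have inner: "u \<bullet> v = Re (\<Sum>i\<in>UNIV. cnj (u $ i) * v $ i)" for u v :: "complex^'n"
    by (simp add: inner_vec_def inner_complex_def)
  have "(\<Sum>i\<in>UNIV. cnj (x $ i) * (A *v y) $ i)
      = (\<Sum>i\<in>UNIV. \<Sum>j\<in>UNIV. cnj (x $ i) * A $ i $ j * y $ j)"
    by (simp add: matrix_vector_mult_def sum_distrib_left mult.assoc)
  also have "\<dots> = (\<Sum>j\<in>UNIV. \<Sum>i\<in>UNIV. cnj (x $ i) * A $ i $ j * y $ j)"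
    by (rule sum.swap)
  also have "\<dots> = (\<Sum>j\<in>UNIV. cnj ((A\<^sup>\<dagger> *v x) $ j) * y $ j)"
    by (simp add: matrix_vector_mult_def sum_distrib_left sum_distrib_right mult_ac)
  finally show ?thesis
    by (simp only: inner)
qed

lemma Re_quad_form: "Re (quad_form A x) = x \<bullet> (A *v x)"
  by (simp add: quad_form_def inner_vec_def inner_complex_def)

lemma pos_semidef_mat_inner:
  "pos_semidef_mat A \<longleftrightarrow> A\<^sup>\<dagger> = A \<and> (\<forall>x. 0 \<le> x \<bullet> (A *v x))"
  by (simp add: pos_semidef_mat_def hermitian_mat_def Re_quad_form)

lemma pos_def_mat_inner:
  "pos_def_mat A \<longleftrightarrow> A\<^sup>\<dagger> = A \<and> (\<forall>x. x \<noteq> 0 \<longrightarrow> 0 < x \<bullet> (A *v x))"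
  by (simp add: pos_def_mat_def hermitian_mat_def Re_quad_form)

lemma continuous_on_matrix_vector:
  "continuous_on X f \<Longrightarrow> continuous_on X (\<lambda>t. A *v (f t :: complex^'n::finite))"
  unfolding matrix_vector_mult_def by (intro continuous_intros continuous_on_vec_lambda)

lemma continuous_on_matrix_vector_left:
  "continuous_on X f \<Longrightarrow> continuous_on X (\<lambda>t. (f t :: 'n::finite cmat) *v x)"
  unfolding matrix_vector_mult_def by (intro continuous_intros continuous_on_vec_lambda)

lemma continuous_on_matrix_mult:
  "continuous_on X f \<Longrightarrow> continuous_on X g \<Longrightarrow>
    continuous_on X (\<lambda>t. (f t :: 'n::finite cmat) ** g t)"
  unfolding matrix_matrix_mult_def by (intro continuous_intros continuous_on_vec_lambda)

lemma continuous_on_ct: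
  "continuous_on X f \<Longrightarrow> continuous_on X (\<lambda>t. (f t :: 'n::finite cmat)\<^sup>\<dagger>)"
  unfolding conj_transpose_def transpose_def map_matrix_def
  by (simp, intro continuous_intros continuous_on_vec_lambda)

lemma inner_ct_matrix_vector: "x \<bullet> (A\<^sup>\<dagger> *v x) = x \<bullet> (A *v (x :: complex^'n::finite))"
  using inner_matrix_vector[of x A x] by (simp add: inner_commute)

section \<open>Positive semidefinite matrices and the Lyapunov inequality\<close>

text \<open>If \<open>y = A *v x\<close> were nonzero, a small move from \<open>x\<close> along
  \<open>- y\<close> would change the form by a negative first-order term and make it
  negative.\<close>

lemma pos_semidef_null_vector:
  assumes "pos_semidef_mat A" "x \<bullet> (A *v x) = 0"
  shows "A *v x = 0"
proof (rule ccontr)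
  assume nz: "A *v x \<noteq> 0"
  define y where "y = A *v x"
  define q where "q = y \<bullet> (A *v y)"
  \<comment> \<open>Small enough that \<open>s * q \<le> y \<bullet> y\<close>, so the quadratic
    term cannot compensate the linear term \<open>- 2 * (y \<bullet> y)\<close>.\<close>
  define s where "s = (y \<bullet> y) / (q + 1)"
  have herm: "A\<^sup>\<dagger> = A" and psd: "\<And>z. 0 \<le> z \<bullet> (A *v z)"
    using assms by (auto simp: pos_semidef_mat_inner)
  have q: "0 \<le> q" and y: "0 < y \<bullet> y"
    using psd nz by (auto simp: q_def y_def)
  have s: "0 < s"
    using q y by (simp add: s_def)
  have "x \<bullet> (A *v y) = y \<bullet> y"
    by (simp add: inner_matrix_vector herm y_def)
  then have "(x - s *\<^sub>R y) \<bullet> (A *v (x - s *\<^sub>R y)) = s * (s * q - 2 * (y \<bullet> y))"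
    using assms(2) by (simp add: algebra_simps inner_diff_left inner_diff_right
        matrix_vector_scaleR q_def flip: y_def)
  then have "0 \<le> s * q - 2 * (y \<bullet> y)"
    using psd[of "x - s *\<^sub>R y"] s by (simp add: zero_le_mult_iff)
  moreover have "s * q \<le> y \<bullet> y"
    using q y by (simp add: s_def field_simps)
  ultimately show False
    using y by simp
qed

lemma pos_semidef_antisym:
  assumes "pos_semidef_mat A" "pos_semidef_mat (- A)"
  shows "A = 0"
proof -
  have "A *v x = 0" for x
  proof -
    have "- A *v x = - (A *v x)"
      using matrix_vector_mult_diff_rdistrib[of 0 A x] by simp
    then have "x \<bullet> (A *v x) = 0"
      using assms by (auto simp: pos_semidef_mat_inner intro: antisym dest!: spec[of _ x])
    then show ?thesis
      using assms(1) pos_semidef_null_vector by blast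
  qed
  then show ?thesis
    by (simp add: matrix_eq)
qed

lemma sphere_min:
  fixes f :: "complex^'n::finite \<Rightarrow> real"
  assumes "continuous_on (sphere 0 1) f"
  obtains x where "norm x = 1" "\<And>y. norm y = 1 \<Longrightarrow> f x \<le> f y"
  using continuous_attains_inf[of "sphere 0 1" f] assms by auto

lemma pos_def_imp_semidef: "pos_def_mat A \<Longrightarrow> pos_semidef_mat A"
  unfolding pos_semidef_mat_inner pos_def_mat_inner
  by (metis inner_zero_left less_le order_refl)

lemma pos_def_mat_pos: "pos_def_mat A \<Longrightarrow> norm x = 1 \<Longrightarrow> 0 < x \<bullet> (A *v x)"
  unfolding pos_def_mat_inner by (metis norm_zero zero_neq_one)

text \<open>A semidefinite form vanishes only on the kernel, so definiteness can be checked by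
  showing that the kernel is trivial.\<close>

lemma pos_def_iff_semidef_inj:
  "pos_def_mat A \<longleftrightarrow> pos_semidef_mat A \<and> (\<forall>x. A *v x = 0 \<longrightarrow> x = 0)"
proof
  show "pos_def_mat A \<Longrightarrow> pos_semidef_mat A \<and> (\<forall>x. A *v x = 0 \<longrightarrow> x = 0)"
    using pos_def_imp_semidef unfolding pos_def_mat_inner by (metis inner_zero_right less_irrefl)
  show "pos_semidef_mat A \<and> (\<forall>x. A *v x = 0 \<longrightarrow> x = 0) \<Longrightarrow> pos_def_mat A"
    unfolding pos_def_mat_inner
    by (metis less_le pos_semidef_mat_inner pos_semidef_null_vector)
qed

lemma quadratic_scaleR:
  "(a *\<^sub>R x) \<bullet> (A *v (a *\<^sub>R x)) = a\<^sup>2 * (x \<bullet> (A *v (x :: complex^'n::finite)))"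
  by (simp add: matrix_vector_scaleR power2_eq_square)

lemma pos_semidef_if_sphere:
  assumes "A\<^sup>\<dagger> = A" "\<And>x. norm x = 1 \<Longrightarrow> 0 \<le> x \<bullet> (A *v x)"
  shows "pos_semidef_mat A"
proof -
  have "0 \<le> x \<bullet> (A *v x)" for x
  proof (cases "x = 0")
    case False
    then have "0 \<le> (norm x)\<^sup>2 * (sgn x \<bullet> (A *v sgn x))"
      using assms(2) by (simp add: norm_sgn)
    then show ?thesis
      using False quadratic_scaleR[of "norm x" "sgn x" A] by (simp add: sgn_div_norm)
  qed auto
  then show ?thesis
    using assms(1) by (simp add: pos_semidef_mat_inner)
qed

text \<open>The constant is the minimum of the form on the unit sphere; being attained, it is
  positive. Semidefiniteness of \<open>A - p *\<^sub>R mat 1\<close> extends the bound to all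
  vectors.\<close>

lemma pos_def_coercive:
  assumes "pos_def_mat A"
  obtains p where "0 < p" "\<And>x. p * (norm x)\<^sup>2 \<le> x \<bullet> (A *v x)"
proof -
  obtain x where x: "norm x = 1" "\<And>y. norm y = 1 \<Longrightarrow> x \<bullet> (A *v x) \<le> y \<bullet> (A *v y)"
    using sphere_min[OF continuous_on_inner[OF continuous_on_id
          continuous_on_matrix_vector[OF continuous_on_id]], of A] by blast
  define p where "p = x \<bullet> (A *v x)"
  have "pos_semidef_mat (A - p *\<^sub>R mat 1)"
  proof (rule pos_semidef_if_sphere)
    show "(A - p *\<^sub>R mat 1)\<^sup>\<dagger> = A - p *\<^sub>R mat 1"
      using assms by (simp add: cmat_simps pos_def_mat_inner)
    show "0 \<le> y \<bullet> ((A - p *\<^sub>R mat 1) *v y)" if "norm y = 1" for y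
      using x(2)[OF that] that by (simp add: matrix_vector_mult_diff_rdistrib scaleR_matrix_vector
          inner_diff_right p_def norm_eq_1)
  qed
  then have "p * (norm y)\<^sup>2 \<le> y \<bullet> (A *v y)" for y
    by (auto simp: pos_semidef_mat_inner matrix_vector_mult_diff_rdistrib scaleR_matrix_vector
          inner_diff_right power2_norm_eq_inner)
  moreover have "0 < p"
    using assms x(1) by (simp add: p_def pos_def_mat_pos)
  ultimately show ?thesis
    using that by blast
qed

(* If x minimises the ratio of the two quadratic forms, with value m, then Y - m L is positive
   semidefinite and hence annihilates x; so x . F Y x = m (x . F L x), which forces m >= 0. *)
lemma lyapunov_pos_semidef:
  assumes L: "pos_def_mat L" and FL: "\<And>x. x \<noteq> 0 \<Longrightarrow> x \<bullet> ((F ** L) *v x) < 0"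
    and Y: "Y\<^sup>\<dagger> = Y" and FY: "\<And>x. x \<bullet> ((F ** Y) *v x) \<le> 0"
  shows "pos_semidef_mat Y"
proof -
  define r where "r = (\<lambda>x. (x \<bullet> (Y *v x)) / (x \<bullet> (L *v x)))"
  have Lpos: "0 < x \<bullet> (L *v x)" if "norm x = 1" for x
    using L that by (rule pos_def_mat_pos)
  have "continuous_on (sphere 0 1) r"
    unfolding r_def
    by (intro continuous_on_divide continuous_on_inner continuous_on_matrix_vector continuous_on_id)
      (use Lpos in force)
  then obtain x where x: "norm x = 1" and min: "\<And>y. norm y = 1 \<Longrightarrow> r x \<le> r y"
    using sphere_min by blast
  have M: "pos_semidef_mat (Y - r x *\<^sub>R L)"
  proof (rule pos_semidef_if_sphere)
    show "(Y - r x *\<^sub>R L)\<^sup>\<dagger> = Y - r x *\<^sub>R L"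
      using Y L by (simp add: cmat_simps pos_def_mat_inner)
    fix y :: "complex^'a" assume y: "norm y = 1"
    have "r x * (y \<bullet> (L *v y)) \<le> y \<bullet> (Y *v y)"
      using min[OF y] Lpos[OF y] by (simp add: r_def[of] field_simps)
    then show "0 \<le> y \<bullet> ((Y - r x *\<^sub>R L) *v y)"
      by (simp add: matrix_vector_mult_diff_rdistrib scaleR_matrix_vector inner_diff_right)
  qed
  have "x \<bullet> ((Y - r x *\<^sub>R L) *v x) = 0"
    using Lpos[OF x] by (simp add: matrix_vector_mult_diff_rdistrib scaleR_matrix_vector
        inner_diff_right r_def)
  then have "(Y - r x *\<^sub>R L) *v x = 0"
    by (rule pos_semidef_null_vector[OF M])
  then have "Y *v x = r x *\<^sub>R (L *v x)"
    by (simp add: matrix_vector_mult_diff_rdistrib scaleR_matrix_vector)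
  then have "x \<bullet> ((F ** Y) *v x) = r x * (x \<bullet> ((F ** L) *v x))"
    by (simp add: matrix_vector_scaleR flip: matrix_vector_mul_assoc)
  moreover have "x \<bullet> ((F ** L) *v x) < 0"
    using FL[of x] x by force
  ultimately have "0 \<le> r x"
    using FY[of x] by (auto simp: mult_le_0_iff)
  have "0 \<le> y \<bullet> (Y *v y)" if "norm y = 1" for y
  proof -
    have "0 \<le> r y"
      using \<open>0 \<le> r x\<close> min[OF that] by simp
    then show ?thesis
      using Lpos[OF that] by (simp add: r_def zero_le_divide_iff)
  qed
  then show ?thesis
    using Y by (intro pos_semidef_if_sphere)
qed

section \<open>Quadratic forms and norm bounds\<close>

text \<open>A matrix and its adjoint have the same real quadratic form. This lets the sign of a
  Lyapunov expression \<open>F ** D + D ** F\<^sup>\<dagger>\<close> with Hermitian \<open>D\<close>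
  be read off from \<open>F ** D\<close> alone.\<close>

lemma inner_add_ct: "x \<bullet> ((A + A\<^sup>\<dagger>) *v x) = 2 * (x \<bullet> (A *v (x :: complex^'n::finite)))"
  by (simp add: matrix_vector_mult_add_rdistrib inner_add_right inner_ct_matrix_vector)

lemma matrix_vector_minus: "(- A) *v x = - ((A :: 'n::finite cmat) *v x)"
  using matrix_vector_mult_diff_rdistrib[of 0 A x] by simp

lemma matrix_mult_minus: "A ** (- B) = - (A ** (B :: 'n::finite cmat))"
  using matrix_minus_ldistrib[of A 0 B] by simp

lemma minus_matrix_mult: "(- A) ** B = - (A ** (B :: 'n::finite cmat))"
  using matrix_minus_rdistrib[of 0 A B] by simp

lemma matrix_vector_axis [simp]: "((M :: 'n::finite cmat) *v axis j 1) $ i = M $ i $ j"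
  by (simp add: matrix_vector_mult_def axis_def if_distrib cong: if_cong)

lemma norm_vec_le_sum: "norm v \<le> (\<Sum>i\<in>UNIV. norm (v $ i))"
  unfolding norm_vec_def by (rule L2_set_le_sum) auto

text \<open>Each entry is a coordinate of the image of a unit axis vector, so a uniform bound on the
  unit sphere bounds every entry.\<close>

lemma bounded_cmat:
  fixes T :: "'n::finite cmat set"
  assumes "\<And>M x. M \<in> T \<Longrightarrow> norm x = 1 \<Longrightarrow> norm (M *v x) \<le> c"
  shows "bounded T"
proof -
  have "norm M \<le> (\<Sum>i\<in>(UNIV :: 'n set). \<Sum>j\<in>(UNIV :: 'n set). c)" if "M \<in> T" for M
  proof -
    have "norm (M $ i $ j) \<le> c" for i j
    proof -
      have "norm (M $ i $ j) = norm ((M *v axis j 1) $ i)"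
        by simp
      also have "\<dots> \<le> norm (M *v axis j 1)"
        by (rule Finite_Cartesian_Product.norm_nth_le)
      also have "norm (axis j (1 :: complex)) = 1"
        by (simp add: norm_eq_sqrt_inner inner_axis_axis inner_complex_def)
      then have "norm (M *v axis j 1) \<le> c"
        using assms that by blast
      finally show ?thesis .
    qed
    then have "norm (M $ i) \<le> (\<Sum>j\<in>(UNIV :: 'n set). c)" for i
      by (rule order_trans[OF norm_vec_le_sum sum_mono])
    then show ?thesis
      by (rule order_trans[OF norm_vec_le_sum sum_mono])
  qed
  then show ?thesis
    by (rule boundedI)
qed

text \<open>Expand the nonnegative form at \<open>x - s *\<^sub>R y\<close> with
  \<open>y = L *v x\<close> and \<open>s = 1 / c\<close>, and bound the forms at \<open>x\<close>
  and at \<open>y\<close> by \<open>c\<close>. What remains is the claim, squared.\<close>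

lemma pos_semidef_norm_le:
  assumes L: "pos_semidef_mat L" and c: "0 < c" and Lc: "\<And>x. x \<bullet> (L *v x) \<le> c * (norm x)\<^sup>2"
  shows "norm (L *v x) \<le> c * norm x"
proof -
  define y where "y = L *v x"
  define s where "s = 1 / c"
  have herm: "L\<^sup>\<dagger> = L"
    using L by (simp add: pos_semidef_mat_inner)
  have xy: "x \<bullet> (L *v y) = y \<bullet> y"
    by (simp add: inner_matrix_vector herm y_def)
  have "0 \<le> (x - s *\<^sub>R y) \<bullet> (L *v (x - s *\<^sub>R y))"
    using L by (simp add: pos_semidef_mat_inner)
  also have "\<dots> = x \<bullet> y - 2 * s * (y \<bullet> y) + s\<^sup>2 * (y \<bullet> (L *v y))"
    by (simp add: matrix_vector_mult_diff_distrib inner_diff_left inner_diff_right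
        matrix_vector_scaleR xy power2_eq_square inner_commute algebra_simps flip: y_def)
  also have "\<dots> \<le> c * (norm x)\<^sup>2 - 2 * s * (norm y)\<^sup>2 + s\<^sup>2 * (c * (norm y)\<^sup>2)"
    using Lc[of x] Lc[of y] by (intro add_mono diff_mono mult_left_mono)
      (use c in \<open>auto simp: y_def s_def power2_norm_eq_inner\<close>)
  also have "\<dots> = (c\<^sup>2 * (norm x)\<^sup>2 - (norm y)\<^sup>2) / c"
    using c by (simp add: s_def field_simps power2_eq_square)
  finally have "(norm y)\<^sup>2 \<le> (c * norm x)\<^sup>2"
    using c by (simp add: zero_le_divide_iff power_mult_distrib)
  then show ?thesis
    unfolding y_def by (rule power2_le_imp_le) (use c in simp)
qed

lemma quadratic_le:
  fixes A :: "'n::finite cmat"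
  obtains q where "0 \<le> q" "\<And>x. x \<bullet> (A *v x) \<le> q * (norm x)\<^sup>2"
proof
  show "0 \<le> onorm ((*v) A)"
    by (simp add: onorm_pos_le)
  fix x :: "complex^'n"
  have "x \<bullet> (A *v x) \<le> norm x * norm (A *v x)"
    by (rule norm_cauchy_schwarz)
  also have "\<dots> \<le> norm x * (onorm ((*v) A) * norm x)"
    by (intro mult_left_mono onorm) auto
  finally show "x \<bullet> (A *v x) \<le> onorm ((*v) A) * (norm x)\<^sup>2"
    by (simp add: power2_eq_square mult_ac)
qed

section \<open>Unique solvability of the Lyapunov equation\<close>

text \<open>The forms of \<open>F ** D\<close> and \<open>F ** (- D)\<close> both vanish, so both
  \<open>D\<close> and \<open>- D\<close> are positive semidefinite.\<close>

lemma lyapunov_injective: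
  assumes L: "pos_def_mat L" and FL: "\<And>x. x \<noteq> 0 \<Longrightarrow> x \<bullet> ((F ** L) *v x) < 0"
    and D: "D\<^sup>\<dagger> = D" "F ** D + D ** F\<^sup>\<dagger> = 0"
  shows "D = 0"
proof -
  have "x \<bullet> ((F ** D) *v x) = 0" for x
    using inner_add_ct[of x "F ** D"] D by (simp add: ct_mult)
  moreover have "(- D)\<^sup>\<dagger> = - D"
    using D ct_diff[of 0 D] by simp
  ultimately show ?thesis
    using D(1) by (intro pos_semidef_antisym lyapunov_pos_semidef[OF L FL])
      (auto simp: matrix_mult_minus matrix_vector_minus)
qed

text \<open>The Lyapunov operator maps the real vector space of Hermitian matrices into itself
  injectively, hence onto by comparing dimensions.\<close>

lemma lyapunov_solution:
  assumes L: "pos_def_mat L" and FL: "\<And>x. x \<noteq> 0 \<Longrightarrow> x \<bullet> ((F ** L) *v x) < 0"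
    and Q: "Q\<^sup>\<dagger> = Q"
  obtains D where "D\<^sup>\<dagger> = D" "F ** D + D ** F\<^sup>\<dagger> = Q"
proof -
  define f where "f = (\<lambda>D. F ** D + D ** F\<^sup>\<dagger>)"
  define H where "H = {D :: 'a cmat. D\<^sup>\<dagger> = D}"
  have f: "linear f"
    by (rule linearI) (simp_all add: f_def cmat_simps scaleR_right_distrib)
  have H: "subspace H"
    by (simp add: subspace_def H_def ct_add ct_scaleR)
  have fH: "f ` H \<subseteq> H"
    by (auto simp: f_def H_def cmat_simps add.commute)
  have "inj_on f H"
  proof (rule inj_onI)
    fix D E assume "D \<in> H" "E \<in> H" "f D = f E"
    then have "f (D - E) = 0" "(D - E)\<^sup>\<dagger> = D - E"
      using linear_diff[OF f] by (simp_all add: H_def ct_diff)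
    then have "D - E = 0"
      using lyapunov_injective[OF L FL, of "D - E"] by (simp add: f_def)
    then show "D = E" by simp
  qed
  then have "dim (f ` H) = dim H"
    using f H by (intro dim_image_eq) (simp_all add: span_eq_iff[THEN iffD2])
  then have "f ` H = H"
    using f H fH by (intro subspace_dim_equal linear_subspace_image) auto
  then have "Q \<in> f ` H"
    using Q by (simp add: H_def)
  then show ?thesis
    using that by (auto simp: f_def H_def)
qed

section \<open>The algebraic Riccati equation\<close>

lemma closed_pos_semidef: "closed {L :: 'n::finite cmat. pos_semidef_mat L}"
  unfolding pos_semidef_mat_inner
  by (intro closed_Collect_conj closed_Collect_eq closed_Collect_all closed_Collect_le
      continuous_on_inner continuous_on_ct continuous_on_matrix_vector_left continuous_on_id
      continuous_on_const)

(* A Newton step from a matrix in K = {0 <= L <= c I, ric L <= 0} stays in K and does not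
   increase the trace, and it leaves the trace fixed only if ric L = 0. *)
theorem riccati_solution:
  fixes A P Q :: "'n::finite cmat"
  assumes Q: "pos_def_mat Q" and P: "pos_def_mat P"
  obtains L where "pos_def_mat L" "Q + A ** L + L ** A\<^sup>\<dagger> - L ** P ** L = 0"
proof -
  define ric where "ric = (\<lambda>L. Q + A ** L + L ** A\<^sup>\<dagger> - L ** P ** L)"
  have Q': "Q\<^sup>\<dagger> = Q" and P': "P\<^sup>\<dagger> = P" and P0: "\<And>x. 0 \<le> x \<bullet> (P *v x)"
    using P Q pos_def_imp_semidef[OF P] by (auto simp: pos_def_mat_inner pos_semidef_mat_inner)
  obtain p where p: "0 < p" "\<And>x. p * (norm x)\<^sup>2 \<le> x \<bullet> (P *v x)"
    using pos_def_coercive[OF P] by blast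
  obtain q where q: "0 \<le> q" "\<And>x. x \<bullet> (Q *v x) \<le> q * (norm x)\<^sup>2"
    using quadratic_le by blast
  obtain a where a: "0 \<le> a" "\<And>x. x \<bullet> (A *v x) \<le> a * (norm x)\<^sup>2"
    using quadratic_le by blast
  \<comment> \<open>Chosen so that \<open>(c - 1) * p = q + 2 * a\<close>. Then
    \<open>q + 2 * c * a \<le> c * (q + 2 * a) \<le> c\<^sup>2 * p\<close>, which places
    \<open>c *\<^sub>R mat 1\<close> in \<open>K\<close>.\<close>
  define c where "c = 1 + (q + 2 * a) / p"
  have c: "1 \<le> c"
    using p q a by (simp add: c_def)
  define K where "K = {L. pos_semidef_mat L \<and> (\<forall>x. x \<bullet> (ric L *v x) \<le> 0)
      \<and> (\<forall>x. x \<bullet> (L *v x) \<le> c * (norm x)\<^sup>2)}"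
  have "c *\<^sub>R mat 1 \<in> K"
  proof -
    have "x \<bullet> (ric (c *\<^sub>R mat 1) *v x) \<le> 0" for x
    proof -
      have "q + 2 * c * a \<le> c * (q + 2 * a)"
        using mult_right_mono[OF c q(1)] by (simp add: algebra_simps)
      also have "q + 2 * a = (c - 1) * p"
        using p by (simp add: c_def)
      also have "c * ((c - 1) * p) \<le> c\<^sup>2 * p"
        unfolding power2_eq_square mult.assoc
        by (intro mult_left_mono mult_right_mono) (use c p in auto)
      finally have *: "(q + 2 * c * a) * (norm x)\<^sup>2 \<le> c\<^sup>2 * p * (norm x)\<^sup>2"
        by (rule mult_right_mono) simp
      have "x \<bullet> (ric (c *\<^sub>R mat 1) *v x)
          = x \<bullet> (Q *v x) + 2 * c * (x \<bullet> (A *v x)) - c\<^sup>2 * (x \<bullet> (P *v x))"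
        by (simp add: ric_def cmat_simps matrix_vector_mult_diff_rdistrib
            matrix_vector_mult_add_rdistrib scaleR_matrix_vector inner_add_right inner_diff_right
            inner_ct_matrix_vector power2_eq_square)
      also have "\<dots> \<le> q * (norm x)\<^sup>2 + 2 * c * (a * (norm x)\<^sup>2) - c\<^sup>2 * (p * (norm x)\<^sup>2)"
        using c p(2) q(2) a(2) by (intro add_mono diff_mono mult_left_mono) auto
      finally show ?thesis
        using * by (simp add: algebra_simps)
    qed
    then show ?thesis
      using c by (auto simp: K_def pos_semidef_mat_inner cmat_simps scaleR_matrix_vector
          power2_norm_eq_inner)
  qed
  then have "K \<noteq> {}"
    by blast
  have "closed K"
    unfolding K_def ric_def
    by (intro closed_Collect_conj closed_pos_semidef closed_Collect_all closed_Collect_le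
        continuous_on_inner continuous_on_matrix_vector_left continuous_on_matrix_mult
        continuous_on_add continuous_on_diff continuous_on_id continuous_on_const)
  moreover have "bounded K"
  proof (rule bounded_cmat)
    fix M and x :: "complex^'n" assume "M \<in> K" "norm x = 1"
    then show "norm (M *v x) \<le> c"
      using c pos_semidef_norm_le[of M c x] by (simp add: K_def)
  qed
  ultimately have "compact K"
    by (simp add: compact_eq_bounded_closed)
  \<comment> \<open>The real part of the trace, written with quadratic forms so that
    semidefiniteness applies to each summand.\<close>
  define tr where "tr = (\<lambda>L :: 'n cmat. \<Sum>i\<in>UNIV. axis i 1 \<bullet> (L *v axis i 1))"
  have "continuous_on K tr"
    unfolding tr_def
    by (intro continuous_on_sum continuous_on_inner continuous_on_matrix_vector_left
        continuous_on_id continuous_on_const)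
  then obtain L where "L \<in> K" and min: "\<And>Y. Y \<in> K \<Longrightarrow> tr L \<le> tr Y"
    using continuous_attains_inf[OF \<open>compact K\<close> \<open>K \<noteq> {}\<close>] by blast
  then have Lsd: "pos_semidef_mat L" and ricL: "\<And>x. x \<bullet> (ric L *v x) \<le> 0"
    and Lc: "\<And>x. x \<bullet> (L *v x) \<le> c * (norm x)\<^sup>2"
    by (auto simp: K_def)
  have L': "L\<^sup>\<dagger> = L"
    using Lsd by (simp add: pos_semidef_mat_inner)
  have LPL: "x \<bullet> ((D ** P ** D) *v x) = (D *v x) \<bullet> (P *v (D *v x))" if "D\<^sup>\<dagger> = D" for D x
    using inner_matrix_vector[of x D "P *v (D *v x)"] that
    by (simp add: matrix_vector_mul_assoc matrix_mul_assoc)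
  \<comment> \<open>On the kernel of \<open>L\<close> the form of \<open>ric L\<close> reduces to
    that of \<open>Q\<close>, which would be positive at a nonzero vector.\<close>
  have Lpd: "pos_def_mat L"
    unfolding pos_def_iff_semidef_inj
  proof (intro conjI allI impI Lsd)
    fix x assume x: "L *v x = 0"
    have "x \<bullet> ((A ** L) *v x) = 0"
      by (simp add: x flip: matrix_vector_mul_assoc)
    moreover have "x \<bullet> ((L ** A\<^sup>\<dagger>) *v x) = x \<bullet> ((A ** L) *v x)"
      using inner_ct_matrix_vector[of x "A ** L"] by (simp add: ct_mult L')
    ultimately have "x \<bullet> (ric L *v x) = x \<bullet> (Q *v x)"
      using LPL[OF L', of x] by (simp add: ric_def matrix_vector_mult_diff_rdistrib
          matrix_vector_mult_add_rdistrib inner_add_right inner_diff_right x)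
    then show "x = 0"
      using ricL[of x] Q by (force simp: pos_def_mat_inner)
  qed
  \<comment> \<open>The derivative of \<open>ric\<close> at \<open>L\<close> sends a Hermitian
    \<open>D\<close> to \<open>F ** D + D ** F\<^sup>\<dagger>\<close>.\<close>
  define F where "F = A - L ** P"
  have ric': "(ric L)\<^sup>\<dagger> = ric L"
    by (simp add: ric_def cmat_simps L' P' Q')
  have Fsym: "2 * (x \<bullet> ((F ** D) *v x)) = x \<bullet> ((F ** D + D ** F\<^sup>\<dagger>) *v x)" if "D\<^sup>\<dagger> = D" for D x
    using inner_add_ct[of x "F ** D"] that by (simp add: ct_mult)
  \<comment> \<open>The right-hand side is negative definite, so \<open>L\<close> itself serves as
    the reference matrix in the Lyapunov lemmas.\<close>
  have FL: "F ** L + L ** F\<^sup>\<dagger> = ric L - Q - L ** P ** L"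
    by (simp add: F_def ric_def cmat_simps L' P')
  have "x \<bullet> ((F ** L) *v x) < 0" if "x \<noteq> 0" for x
    using Fsym[OF L', of x] ricL[of x] Q that P0[of "L *v x"]
    by (simp add: FL matrix_vector_mult_diff_rdistrib inner_diff_right LPL L' pos_def_mat_inner)
      (smt (verit))
  note lyap = Lpd this
  have mric: "(- ric L)\<^sup>\<dagger> = - ric L"
    using ric' ct_diff[of 0 "ric L"] by simp
  \<comment> \<open>\<open>D\<close> is the Newton correction: to first order, \<open>L + D\<close>
    solves the equation.\<close>
  obtain D where D: "D\<^sup>\<dagger> = D" "F ** D + D ** F\<^sup>\<dagger> = - ric L"
    using lyapunov_solution[OF lyap mric] by blast
  have mD: "pos_semidef_mat (- D)"
  proof (rule lyapunov_pos_semidef[OF lyap])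
    show "(- D)\<^sup>\<dagger> = - D"
      using D(1) ct_diff[of 0 D] by simp
    show "x \<bullet> ((F ** - D) *v x) \<le> 0" for x
      using Fsym[OF D(1), of x] ricL[of x] D(2) by (simp add: matrix_mult_minus matrix_vector_minus)
  qed
  have LD': "(L + D)\<^sup>\<dagger> = L + D"
    by (simp add: ct_add L' D(1))
  have "pos_semidef_mat (L + D)"
  proof (rule lyapunov_pos_semidef[OF lyap LD'])
    fix x
    have "F ** (L + D) + (L + D) ** F\<^sup>\<dagger>
        = (F ** L + L ** F\<^sup>\<dagger>) + (F ** D + D ** F\<^sup>\<dagger>)"
      by (simp only: cmat_simps) simp
    also have "\<dots> = - (Q + L ** P ** L)"
      by (simp add: FL D(2))
    finally have "2 * (x \<bullet> ((F ** (L + D)) *v x)) = - (x \<bullet> ((Q + L ** P ** L) *v x))"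
      using Fsym[OF LD', of x] by (simp only: matrix_vector_minus inner_minus_right)
    then show "x \<bullet> ((F ** (L + D)) *v x) \<le> 0"
      using P0[of "L *v x"] pos_def_imp_semidef[OF Q]
      by (simp add: matrix_vector_mult_add_rdistrib inner_add_right LPL L' pos_semidef_mat_inner)
        (smt (verit))
  qed
  moreover have "x \<bullet> (ric (L + D) *v x) \<le> 0" for x
  proof -
    \<comment> \<open>Since \<open>ric\<close> is quadratic, the Taylor expansion at
      \<open>L\<close> is exact; the Newton choice of \<open>D\<close> leaves only the second-order
      term.\<close>
    have "ric (L + D) = ric L + (F ** D + D ** F\<^sup>\<dagger>) - D ** P ** D"
      by (simp add: ric_def F_def cmat_simps L' P' D(1) algebra_simps)
    also have "\<dots> = - (D ** P ** D)"
      by (simp add: D(2))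
    finally show ?thesis
      using P0[of "D *v x"] by (simp add: matrix_vector_minus LPL D(1))
  qed
  moreover have "x \<bullet> ((L + D) *v x) \<le> c * (norm x)\<^sup>2" for x
    using Lc[of x] mD by (simp add: matrix_vector_mult_add_rdistrib inner_add_right
        pos_semidef_mat_inner matrix_vector_minus) (smt (verit))
  ultimately have "tr L \<le> tr (L + D)"
    by (intro min) (simp add: K_def)
  then have "tr (- D) \<le> 0"
    by (simp add: tr_def matrix_vector_mult_add_rdistrib inner_add_right sum.distrib
        matrix_vector_minus sum_negf)
  \<comment> \<open>The diagonal forms of \<open>- D\<close> are nonnegative with sum at most 0, so
    all vanish; the null vector lemma then annihilates every column of \<open>D\<close>.\<close>
  moreover have "0 \<le> axis i 1 \<bullet> (- D *v axis i 1)" for i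
    using mD by (simp add: pos_semidef_mat_inner)
  ultimately have "axis i 1 \<bullet> (- D *v axis i 1) = 0" for i
    unfolding tr_def by (metis (no_types, lifting) UNIV_I antisym finite sum_nonneg
        sum_nonneg_eq_0_iff)
  then have "- D *v axis i 1 = 0" for i
    using mD pos_semidef_null_vector by blast
  then have "D = 0"
    by (simp add: matrix_vector_minus vec_eq_iff)
  then have "ric L = 0"
    using D(2) by simp
  then show ?thesis
    using that Lpd by (simp add: ric_def)
qed

section \<open>Inverses, Gram matrices and square roots\<close>

lemma mat_mult_nth: "(mat c ** (A :: 'n::finite cmat)) $ i $ j = c * A $ i $ j"
  by (simp add: matrix_matrix_mult_def mat_def if_distrib if_distribR cong: if_cong)

lemma inj_imp_inverse:
  fixes A :: "'n::finite cmat"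
  assumes "\<And>x. A *v x = 0 \<Longrightarrow> x = 0"
  obtains B where "A ** B = mat 1" "B ** A = mat 1"
proof -
  have "inj ((*v) A)"
    using assms by (metis (no_types, lifting) eq_iff_diff_eq_0 injI matrix_vector_mult_diff_distrib)
  then show ?thesis
    using that matrix_left_invertible_injective[of A] matrix_left_right_inverse[of A] by blast
qed

lemma pos_def_inverse:
  assumes "pos_def_mat A"
  obtains B where "A ** B = mat 1" "B ** A = mat 1" "B\<^sup>\<dagger> = B"
proof -
  obtain B where B: "A ** B = mat 1" "B ** A = mat 1"
    using assms inj_imp_inverse[of A] by (auto simp: pos_def_iff_semidef_inj)
  have "B\<^sup>\<dagger> = B\<^sup>\<dagger> ** (A ** B)"
    by (simp add: B)
  also have "\<dots> = (A ** B)\<^sup>\<dagger> ** B"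
    using assms by (simp add: cmat_simps pos_def_mat_inner)
  finally show ?thesis
    using B that by simp
qed

lemma inner_gram: "x \<bullet> ((W\<^sup>\<dagger> ** W) *v x) = (norm (W *v x))\<^sup>2"
  using inner_matrix_vector[of x "W\<^sup>\<dagger>" "W *v x"]
  by (simp add: power2_norm_eq_inner flip: matrix_vector_mul_assoc)

lemma pos_def_gram:
  assumes "\<And>x. W *v x = 0 \<Longrightarrow> x = 0"
  shows "pos_def_mat (W\<^sup>\<dagger> ** W)"
  unfolding pos_def_mat_inner inner_gram using assms by (auto simp: ct_mult)

lemma pos_def_one: "pos_def_mat (mat 1)"
  by (simp add: pos_def_mat_inner)

lemma pos_def_one_plus_gram: "pos_def_mat (mat 1 + R ** R\<^sup>\<dagger>)"
proof -
  have "x \<bullet> ((R ** R\<^sup>\<dagger>) *v x) = (norm (R\<^sup>\<dagger> *v x))\<^sup>2" for x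
    using inner_gram[of x "R\<^sup>\<dagger>"] by simp
  then show ?thesis
    by (auto simp: pos_def_mat_inner cmat_simps matrix_vector_mult_add_rdistrib inner_add_right
        intro!: add_pos_nonneg)
qed

(* The difference D of two roots B, E satisfies F D + D F* = 0 for F = -(B + E). *)
lemma psd_sqrt_pos_def:
  assumes A: "pos_def_mat A"
  shows "pos_def_mat (psd_sqrt A)" "psd_sqrt A ** psd_sqrt A = A"
proof -
  \<comment> \<open>Every semidefinite root is definite, because its kernel lies in that of
    \<open>A\<close>.\<close>
  have pd: "pos_def_mat B" if B: "pos_semidef_mat B" "B ** B = A" for B
    unfolding pos_def_iff_semidef_inj
  proof (intro conjI allI impI B(1))
    fix x assume "B *v x = 0"
    then have "A *v x = 0"
      by (simp flip: B(2) matrix_vector_mul_assoc)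
    then show "x = 0"
      using A by (simp add: pos_def_iff_semidef_inj)
  qed
  \<comment> \<open>Existence of a root is the Riccati equation with zero linear coefficient and
    identity quadratic coefficient.\<close>
  obtain T where T: "pos_def_mat T" "A - T ** T = 0"
    using riccati_solution[OF A pos_def_one, of 0] by auto
  have "B = T" if B: "pos_semidef_mat B" "B ** B = A" for B
  proof -
    have herm: "B\<^sup>\<dagger> = B" "T\<^sup>\<dagger> = T"
      using B T by (simp_all add: pos_semidef_mat_inner pos_def_mat_inner)
    define F where "F = - (B + T)"
    have F': "F\<^sup>\<dagger> = F"
      using ct_diff[of 0 "B + T"] by (simp add: F_def ct_add herm)
    have "B - T = 0"
    proof (rule lyapunov_injective[OF pos_def_one])
      show "x \<bullet> ((F ** mat 1) *v x) < 0" if "x \<noteq> 0" for x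
      proof -
        have "0 < x \<bullet> (B *v x)" "0 < x \<bullet> (T *v x)"
          using pd[OF B] T(1) that by (auto simp: pos_def_mat_inner)
        then show ?thesis
          unfolding F_def matrix_mul_rid matrix_vector_minus
          by (simp add: matrix_vector_mult_add_rdistrib inner_diff_right)
      qed
      show "(B - T)\<^sup>\<dagger> = B - T"
        by (simp add: ct_diff herm)
      show "F ** (B - T) + (B - T) ** F\<^sup>\<dagger> = 0"
        unfolding F' using B(2) T(2)
        by (simp add: F_def cmat_simps matrix_mult_minus minus_matrix_mult)
    qed
    then show ?thesis by simp
  qed
  then have "psd_sqrt A = T"
    unfolding psd_sqrt_def using T pos_def_imp_semidef by (intro the_equality) auto
  then show "pos_def_mat (psd_sqrt A)" "psd_sqrt A ** psd_sqrt A = A"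
    using T by simp_all
qed

section \<open>Density of the invertible matrices\<close>

lemma poly_det:
  fixes M :: "('a::comm_ring_1 poly)^'n^'n"
  shows "poly (det M) t = det (\<chi> i j. poly (M $ i $ j) t)"
  by (simp add: det_def poly_sum poly_prod)

(* det (S + t I) is a polynomial in t which does not vanish for t > onorm S. *)
lemma invertible_dense:
  fixes S :: "'n::finite cmat"
  shows "S \<in> closure {M. invertible M}"
proof -
  define p where "p = det (\<chi> i j. [:S $ i $ j, if i = j then 1 else 0:])"
  have p: "poly p t = det (S + mat t)" for t
  proof -
    have "(\<chi> i j. poly [:S $ i $ j, if i = j then 1 else 0:] t) = S + mat t"
      by (simp add: vec_eq_iff mat_def)
    then show ?thesis
      by (simp add: p_def poly_det)
  qed
  have mat: "mat (complex_of_real r) = r *\<^sub>R (mat 1 :: 'n cmat)" for r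
    by (simp add: vec_eq_iff mat_def scaleR_conv_of_real[where 'a = complex])
  \<comment> \<open>A single point with nonzero determinant shows that \<open>p\<close> is not the
    zero polynomial, so \<open>p\<close> has finitely many roots.\<close>
  define u where "u = onorm ((*v) S) + 1"
  have u: "0 < u"
    by (simp add: u_def add_nonneg_pos onorm_pos_le)
  have "x = 0" if "(S + mat (complex_of_real u)) *v x = 0" for x
  proof -
    have "S *v x = - (u *\<^sub>R x)"
      using that by (simp add: mat matrix_vector_mult_add_rdistrib scaleR_matrix_vector
          eq_neg_iff_add_eq_0)
    then have "u * norm x = norm (S *v x)"
      using u by simp
    also have "\<dots> \<le> onorm ((*v) S) * norm x"
      by (rule onorm) simp
    finally show "x = 0"
      by (simp add: u_def algebra_simps)
  qed
  then obtain B where "B ** (S + mat (complex_of_real u)) = mat 1"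
    using inj_imp_inverse by blast
  then have "invertible (S + mat (complex_of_real u))"
    using invertible_left_inverse by blast
  then have "poly p (complex_of_real u) \<noteq> 0"
    by (simp add: p invertible_det_nz)
  then have "finite {t. poly p t = 0}"
    by (intro poly_roots_finite) auto
  then have fin: "finite {r. poly p (complex_of_real r) = 0}"
    using finite_vimageI[of "{t. poly p t = 0}" complex_of_real]
    by (simp add: vimage_def inj_of_real)
  show ?thesis
    unfolding closure_approachable
  proof (intro allI impI)
    fix e :: real assume e: "0 < e"
    \<comment> \<open>Shifts below \<open>d\<close> move \<open>S\<close> by less than
      \<open>e\<close>, and the infinite interval up to \<open>d\<close> contains a value that is
      not a root.\<close>
    define d where "d = e / (norm (mat 1 :: 'n cmat) + 1)"
    have d: "0 < d"
      using e by (simp add: d_def add_nonneg_pos)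
    then have "\<not> {0<..<d} \<subseteq> {r. poly p (complex_of_real r) = 0}"
      using finite_subset[OF _ fin] infinite_Ioo by blast
    then obtain r where "r \<in> {0<..<d}" "r \<notin> {r. poly p (complex_of_real r) = 0}"
      by blast
    then have r: "0 < r" "r < d" "poly p (complex_of_real r) \<noteq> 0"
      by simp_all
    have "invertible (S + r *\<^sub>R mat 1)"
      using r(3) by (simp add: p mat invertible_det_nz)
    moreover have "dist (S + r *\<^sub>R mat 1) S < e"
    proof -
      have "r * norm (mat 1 :: 'n cmat) \<le> r * (norm (mat 1 :: 'n cmat) + 1)"
        using r by simp
      also have "\<dots> < d * (norm (mat 1 :: 'n cmat) + 1)"
        using r by (intro mult_strict_right_mono) (auto simp: add_nonneg_pos)
      also have "\<dots> = e"
        unfolding d_def using norm_ge_zero[of "mat 1 :: 'n cmat"] by (simp add: add_nonneg_eq_0_iff)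
      finally show ?thesis
        using r by (simp add: dist_norm)
    qed
    ultimately show "\<exists>y\<in>{M. invertible M}. dist y S < e"
      by blast
  qed
qed

section \<open>The quadratic equation with a Hermitian side condition\<close>

lemma riccati_hermitian_invertible:
  fixes R S :: "'n::finite cmat"
  assumes "invertible S"
  shows "\<exists>Z. mat 1 + R ** Z + Z\<^sup>\<dagger> ** R\<^sup>\<dagger> - Z\<^sup>\<dagger> ** Z = 0 \<and> (S ** Z)\<^sup>\<dagger> = S ** Z"
proof -
  obtain B where B: "S ** B = mat 1" "B ** S = mat 1"
    using assms by (auto simp: invertible_def)
  have "x = 0" if "B *v x = 0" for x
  proof -
    have "x = S *v (B *v x)"
      by (simp add: matrix_vector_mul_assoc B)
    then show ?thesis
      by (simp add: that)
  qed
  then have "pos_def_mat (B\<^sup>\<dagger> ** B)"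
    by (rule pos_def_gram)
  \<comment> \<open>Substituting \<open>Z = B ** L\<close> gives linear coefficient
    \<open>R ** B\<close> and quadratic coefficient \<open>B\<^sup>\<dagger> ** B\<close>, while
    \<open>S ** Z\<close> becomes \<open>L\<close>.\<close>
  then obtain L where L: "pos_def_mat L"
    "mat 1 + R ** B ** L + L ** (R ** B)\<^sup>\<dagger> - L ** (B\<^sup>\<dagger> ** B) ** L = 0"
    by (rule riccati_solution[OF pos_def_one])
  have "L\<^sup>\<dagger> = L"
    using L(1) by (simp add: pos_def_mat_inner)
  then show ?thesis
    using L(2) by (intro exI[of _ "B ** L"]) (simp add: cmat_simps B)
qed

lemma riccati_hermitian:
  fixes R S :: "'n::finite cmat"
  obtains Z where "mat 1 + R ** Z + Z\<^sup>\<dagger> ** R\<^sup>\<dagger> - Z\<^sup>\<dagger> ** Z = 0" "(S ** Z)\<^sup>\<dagger> = S ** Z"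
proof -
  \<comment> \<open>This set does not depend on \<open>S\<close>, so one compactness argument serves
    all approximations of \<open>S\<close>.\<close>
  define K where "K = {Z. mat 1 + R ** Z + Z\<^sup>\<dagger> ** R\<^sup>\<dagger> - Z\<^sup>\<dagger> ** Z = 0}"
  have "closed K"
    unfolding K_def
    by (intro closed_Collect_eq continuous_on_matrix_mult continuous_on_ct
        continuous_on_add continuous_on_diff continuous_on_id continuous_on_const)
  moreover have "bounded K"
  proof -
    obtain q where q: "0 \<le> q" "\<And>x. x \<bullet> ((mat 1 + R ** R\<^sup>\<dagger>) *v x) \<le> q * (norm x)\<^sup>2"
      using quadratic_le by blast
    show ?thesis
    proof (rule bounded_cmat)
      fix Z and x :: "complex^'n" assume Z: "Z \<in> K" and x: "norm x = 1"
      \<comment> \<open>Completing the square fixes the norm of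
        \<open>(Z - R\<^sup>\<dagger>) *v x\<close> for each \<open>x\<close>, which bounds
        \<open>K\<close>.\<close>
      have "(Z - R\<^sup>\<dagger>)\<^sup>\<dagger> ** (Z - R\<^sup>\<dagger>) = mat 1 + R ** R\<^sup>\<dagger>"
        using Z by (simp add: K_def cmat_simps algebra_simps)
      then have "(norm ((Z - R\<^sup>\<dagger>) *v x))\<^sup>2 \<le> q"
        using q(2)[of x] x inner_gram[of x "Z - R\<^sup>\<dagger>"] by simp
      then have "norm ((Z - R\<^sup>\<dagger>) *v x) \<le> sqrt q"
        by (rule real_le_rsqrt)
      moreover have "norm (R\<^sup>\<dagger> *v x) \<le> onorm ((*v) (R\<^sup>\<dagger>))"
        using onorm[of "(*v) (R\<^sup>\<dagger>)" x] x by simp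
      moreover have "norm (Z *v x) \<le> norm ((Z - R\<^sup>\<dagger>) *v x) + norm (R\<^sup>\<dagger> *v x)"
        using norm_triangle_ineq[of "(Z - R\<^sup>\<dagger>) *v x" "R\<^sup>\<dagger> *v x"]
        by (simp add: matrix_vector_mult_diff_rdistrib)
      ultimately show "norm (Z *v x) \<le> sqrt q + onorm ((*v) (R\<^sup>\<dagger>))"
        by linarith
    qed
  qed
  ultimately have K: "compact K"
    by (simp add: compact_eq_bounded_closed)
  \<comment> \<open>The matrices \<open>M\<close> for which some \<open>Z\<close> in
    \<open>K\<close> makes \<open>M ** Z\<close> Hermitian. As a projection of a closed set along
    the compact \<open>K\<close>, it is closed; it contains the dense set of invertible
    matrices.\<close>
  define G where "G = {M. \<exists>Z. Z \<in> K \<and> (Z, M) \<in> {(Z, M). (M ** Z)\<^sup>\<dagger> = M ** Z}}"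
  have "closed G"
    unfolding G_def
  proof (rule closed_compact_projection[OF K])
    show "closed {(Z, M :: 'n cmat). (M ** Z)\<^sup>\<dagger> = M ** Z}"
      unfolding case_prod_unfold
      by (intro closed_Collect_eq continuous_on_ct continuous_on_matrix_mult continuous_on_fst
          continuous_on_snd continuous_on_id)
  qed
  moreover have "{M. invertible M} \<subseteq> G"
    using riccati_hermitian_invertible[of _ R] by (auto simp: G_def K_def)
  ultimately have "S \<in> G"
    using invertible_dense closure_minimal by blast
  then show ?thesis
    using that by (auto simp: G_def K_def)
qed

section \<open>The six assertions\<close>

lemma equation_b:
  fixes R S :: "'n::finite cmat"
  shows "\<exists>Z. mat 1 + R ** Z + Z\<^sup>\<dagger> ** R\<^sup>\<dagger> - Z\<^sup>\<dagger> ** Z = 0 \<and> S ** Z + Z\<^sup>\<dagger> ** S\<^sup>\<dagger> = 0"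
proof -
  obtain Z where Z: "mat 1 + R ** Z + Z\<^sup>\<dagger> ** R\<^sup>\<dagger> - Z\<^sup>\<dagger> ** Z = 0"
      "(mat \<i> ** S ** Z)\<^sup>\<dagger> = mat \<i> ** S ** Z"
    using riccati_hermitian by blast
  define W where "W = S ** Z"
  have "(W + W\<^sup>\<dagger>) $ i $ j = 0" for i j
  proof -
    have "(mat \<i> ** W)\<^sup>\<dagger> $ i $ j = (mat \<i> ** W) $ i $ j"
      using Z(2) by (simp add: W_def matrix_mul_assoc)
    \<comment> \<open>Hermitian symmetry of the \<open>\<i>\<close>-multiple of \<open>W\<close>
      says, entry by entry, that \<open>W\<close> is skew-Hermitian.\<close>
    then have "\<i> * (W $ i $ j + cnj (W $ j $ i)) = 0"
      by (simp add: mat_mult_nth distrib_left) (metis add.left_inverse)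
    then show ?thesis by simp
  qed
  then have "S ** Z + Z\<^sup>\<dagger> ** S\<^sup>\<dagger> = 0"
    by (simp add: W_def vec_eq_iff flip: ct_mult)
  then show ?thesis
    using Z(1) by blast
qed

lemma equation_a:
  fixes R S :: "'n::finite cmat"
  shows "\<exists>Z. mat 1 + R ** Z + Z\<^sup>\<dagger> ** S\<^sup>\<dagger> - Z\<^sup>\<dagger> ** Z = 0"
proof -
  define M D where "M = (1/2) *\<^sub>R (R + S)" and "D = (1/2) *\<^sub>R (R - S)"
  have R: "R = M + D" and S: "S = M - D"
    by (simp_all add: M_def D_def scaleR_2 flip: scaleR_right_distrib scaleR_right_diff_distrib)
  obtain Z where Z: "mat 1 + M ** Z + Z\<^sup>\<dagger> ** M\<^sup>\<dagger> - Z\<^sup>\<dagger> ** Z = 0" "(D ** Z)\<^sup>\<dagger> = D ** Z"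
    using riccati_hermitian by blast
  \<comment> \<open>The antisymmetric part \<open>D\<close> contributes only the difference of
    \<open>D ** Z\<close> and its adjoint, which vanishes by the side condition.\<close>
  have "mat 1 + R ** Z + Z\<^sup>\<dagger> ** S\<^sup>\<dagger> - Z\<^sup>\<dagger> ** Z
      = (mat 1 + M ** Z + Z\<^sup>\<dagger> ** M\<^sup>\<dagger> - Z\<^sup>\<dagger> ** Z) + (D ** Z - (D ** Z)\<^sup>\<dagger>)"
    by (simp add: R S cmat_simps)
  then show ?thesis
    using Z by auto
qed

text \<open>The two equations differ exactly by the side condition of (b) for
  \<open>S - R\<close>.\<close>

lemma equation_c:
  fixes R S :: "'n::finite cmat"
  shows "\<exists>Z. mat 1 + R ** Z + Z\<^sup>\<dagger> ** R\<^sup>\<dagger> - Z\<^sup>\<dagger> ** Z = 0 \<and>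
    mat 1 + S ** Z + Z\<^sup>\<dagger> ** S\<^sup>\<dagger> - Z\<^sup>\<dagger> ** Z = 0"
proof -
  obtain Z where Z: "mat 1 + R ** Z + Z\<^sup>\<dagger> ** R\<^sup>\<dagger> - Z\<^sup>\<dagger> ** Z = 0"
      "(S - R) ** Z + Z\<^sup>\<dagger> ** (S - R)\<^sup>\<dagger> = 0"
    using equation_b by blast
  have "mat 1 + S ** Z + Z\<^sup>\<dagger> ** S\<^sup>\<dagger> - Z\<^sup>\<dagger> ** Z
      = (mat 1 + R ** Z + Z\<^sup>\<dagger> ** R\<^sup>\<dagger> - Z\<^sup>\<dagger> ** Z) + ((S - R) ** Z + Z\<^sup>\<dagger> ** (S - R)\<^sup>\<dagger>)"
    by (simp add: cmat_simps)
  then show ?thesis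
    using Z by auto
qed

lemma equation_d:
  fixes R P :: "'n::finite cmat"
  assumes "pos_def_mat P"
  shows "\<exists>H. hermitian_mat H \<and> mat 1 + R ** H + H ** R\<^sup>\<dagger> - H ** P ** H = \<gamma> *\<^sub>R H"
proof -
  \<comment> \<open>Shifting by half of \<open>\<gamma>\<close> absorbs the term
    \<open>\<gamma> *\<^sub>R H\<close>, as each of the two linear terms contributes one
    half.\<close>
  define A where "A = R - (\<gamma> / 2) *\<^sub>R mat 1"
  obtain H where H: "pos_def_mat H" "mat 1 + A ** H + H ** A\<^sup>\<dagger> - H ** P ** H = 0"
    using riccati_solution[OF pos_def_one assms] by blast
  have "A ** H + H ** A\<^sup>\<dagger> = R ** H + H ** R\<^sup>\<dagger> - \<gamma> *\<^sub>R H"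
    using scaleR_left_distrib[of "\<gamma> / 2" "\<gamma> / 2" H] by (simp add: A_def cmat_simps)
  then have "mat 1 + R ** H + H ** R\<^sup>\<dagger> - H ** P ** H
      = (mat 1 + A ** H + H ** A\<^sup>\<dagger> - H ** P ** H) + \<gamma> *\<^sub>R H"
    by (simp add: algebra_simps)
  then have "mat 1 + R ** H + H ** R\<^sup>\<dagger> - H ** P ** H = \<gamma> *\<^sub>R H"
    by (simp add: H(2))
  then show ?thesis
    using H(1) by (auto simp: hermitian_mat_def pos_def_mat_inner)
qed

lemma unitary_mat_if_left: "U\<^sup>\<dagger> ** U = mat 1 \<Longrightarrow> unitary_mat U"
  using matrix_left_right_inverse by (auto simp: unitary_mat_def)

lemma equation_e:
  fixes R S :: "'n::finite cmat"
  defines "T \<equiv> psd_sqrt (mat 1 + R ** R\<^sup>\<dagger>)"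
  shows "\<exists>U. unitary_mat U \<and> S ** R\<^sup>\<dagger> + R ** S\<^sup>\<dagger> = S ** U ** T + T ** U\<^sup>\<dagger> ** S\<^sup>\<dagger>"
proof -
  have T: "pos_def_mat T" "T ** T = mat 1 + R ** R\<^sup>\<dagger>"
    using psd_sqrt_pos_def[OF pos_def_one_plus_gram] by (simp_all add: T_def)
  have T': "T\<^sup>\<dagger> = T"
    using T(1) by (simp add: pos_def_mat_inner)
  obtain B where B: "T ** B = mat 1" "B ** T = mat 1" "B\<^sup>\<dagger> = B"
    using pos_def_inverse[OF T(1)] by blast
  obtain Z where Z: "mat 1 + R ** Z + Z\<^sup>\<dagger> ** R\<^sup>\<dagger> - Z\<^sup>\<dagger> ** Z = 0" "S ** Z + Z\<^sup>\<dagger> ** S\<^sup>\<dagger> = 0"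
    using equation_b by blast
  \<comment> \<open>By the first equation \<open>V\<close> has the same Gram matrix as
    \<open>T\<close>, so \<open>V = U ** T\<close> is a polar decomposition. By the second,
    replacing \<open>R\<^sup>\<dagger>\<close> by \<open>V\<close> does not change
    \<open>S ** R\<^sup>\<dagger>\<close> plus its adjoint.\<close>
  define V where "V = R\<^sup>\<dagger> - Z"
  define U where "U = V ** B"
  have "V\<^sup>\<dagger> ** V = T ** T"
    using Z(1) by (simp add: V_def cmat_simps T(2) algebra_simps)
  moreover have "U\<^sup>\<dagger> ** U = B ** (V\<^sup>\<dagger> ** V) ** B"
    by (simp add: U_def ct_mult B(3) matrix_mul_assoc)
  ultimately have "U\<^sup>\<dagger> ** U = B ** (T ** T) ** B"
    by simp
  also have "\<dots> = (B ** T) ** (T ** B)"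
    by (simp only: matrix_mul_assoc)
  also have "\<dots> = mat 1"
    by (simp add: B)
  finally have U: "unitary_mat U"
    by (rule unitary_mat_if_left)
  have UT: "U ** T = V"
    by (simp add: U_def B flip: matrix_mul_assoc)
  then have TU: "T ** U\<^sup>\<dagger> = V\<^sup>\<dagger>"
    using ct_mult[of U T] by (simp add: T')
  have "S ** U ** T + T ** U\<^sup>\<dagger> ** S\<^sup>\<dagger> = S ** V + V\<^sup>\<dagger> ** S\<^sup>\<dagger>"
    by (simp add: UT TU flip: matrix_mul_assoc[of S])
  also have "\<dots> = S ** R\<^sup>\<dagger> + R ** S\<^sup>\<dagger> - (S ** Z + Z\<^sup>\<dagger> ** S\<^sup>\<dagger>)"
    by (simp add: V_def cmat_simps)
  finally have "S ** R\<^sup>\<dagger> + R ** S\<^sup>\<dagger> = S ** U ** T + T ** U\<^sup>\<dagger> ** S\<^sup>\<dagger>"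
    by (simp add: Z(2))
  then show ?thesis
    using U by blast
qed

text \<open>Supplies the positive definite constant term of the Riccati equation behind (f).\<close>

lemma strict_contraction_pos_def:
  assumes "strict_contraction C"
  shows "pos_def_mat (mat 1 - C\<^sup>\<dagger> ** C)"
proof -
  have "(norm (C *v x))\<^sup>2 < (norm x)\<^sup>2" if "x \<noteq> 0" for x
  proof -
    have "norm (C *v x) \<le> onorm ((*v) C) * norm x"
      by (rule onorm) simp
    also have "\<dots> < 1 * norm x"
      using assms that by (intro mult_strict_right_mono) (auto simp: strict_contraction_def)
    finally show ?thesis
      by (simp add: power_strict_mono)
  qed
  then show ?thesis
    by (simp add: pos_def_mat_inner cmat_simps matrix_vector_mult_diff_rdistrib inner_diff_right
        inner_gram power2_norm_eq_inner[of x for x])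
qed

lemma equation_f:
  fixes C P :: "'n::finite cmat"
  assumes P: "pos_def_mat P" and C: "strict_contraction C"
  shows "\<exists>U H. unitary_mat U \<and> hermitian_mat H \<and> C = U + P ** H"
proof -
  have P': "P\<^sup>\<dagger> = P"
    using P by (simp add: pos_def_mat_inner)
  have "pos_def_mat (P\<^sup>\<dagger> ** P)"
    using P by (intro pos_def_gram) (simp add: pos_def_iff_semidef_inj)
  \<comment> \<open>This is the expanded condition that \<open>C - P ** H\<close> has Gram matrix
    \<open>mat 1\<close>.\<close>
  then obtain H where H: "pos_def_mat H"
      "mat 1 - C\<^sup>\<dagger> ** C + C\<^sup>\<dagger> ** P ** H + H ** (C\<^sup>\<dagger> ** P)\<^sup>\<dagger> - H ** (P\<^sup>\<dagger> ** P) ** H = 0"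
    by (rule riccati_solution[OF strict_contraction_pos_def[OF C]])
  have H': "H\<^sup>\<dagger> = H"
    using H(1) by (simp add: pos_def_mat_inner)
  have "(C - P ** H)\<^sup>\<dagger> ** (C - P ** H) = mat 1"
    using H(2) by (simp add: cmat_simps P' H' algebra_simps)
  then have "unitary_mat (C - P ** H)"
    by (rule unitary_mat_if_left)
  then show ?thesis
    using H' by (intro exI[of _ "C - P ** H"] exI[of _ H]) (simp add: hermitian_mat_def)
qed

theorem theorem3p3:
  fixes R S P C :: "'n::finite cmat" and \<gamma> :: real
  assumes "pos_def_mat P" and "strict_contraction C"
  shows
    "(\<exists>Z :: 'n cmat. mat 1 + R ** Z + Z\<^sup>\<dagger> ** S\<^sup>\<dagger> - Z\<^sup>\<dagger> ** Z = 0) \<and>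
     (\<exists>Z :: 'n cmat. mat 1 + R ** Z + Z\<^sup>\<dagger> ** R\<^sup>\<dagger> - Z\<^sup>\<dagger> ** Z = 0 \<and>
                     S ** Z + Z\<^sup>\<dagger> ** S\<^sup>\<dagger> = 0) \<and>
     (\<exists>Z :: 'n cmat. mat 1 + R ** Z + Z\<^sup>\<dagger> ** R\<^sup>\<dagger> - Z\<^sup>\<dagger> ** Z = 0 \<and>
                     mat 1 + S ** Z + Z\<^sup>\<dagger> ** S\<^sup>\<dagger> - Z\<^sup>\<dagger> ** Z = 0) \<and>
     (\<exists>H :: 'n cmat. hermitian_mat H \<and>
                     mat 1 + R ** H + H ** R\<^sup>\<dagger> - H ** P ** H = \<gamma> *\<^sub>R H) \<and>
     (\<exists>U :: 'n cmat. unitary_mat U \<and>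
                     S ** R\<^sup>\<dagger> + R ** S\<^sup>\<dagger> =
                       S ** U ** psd_sqrt (mat 1 + R ** R\<^sup>\<dagger>)
                       + psd_sqrt (mat 1 + R ** R\<^sup>\<dagger>) ** U\<^sup>\<dagger> ** S\<^sup>\<dagger>) \<and>
     (\<exists>U H :: 'n cmat. unitary_mat U \<and> hermitian_mat H \<and> C = U + P ** H)"
  by (intro conjI equation_a equation_b equation_c equation_d[OF assms(1)] equation_e
      equation_f[OF assms])

end
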